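(* Let $G$ be a finite abstract simplicial complex and let $T$ be an automorphism of $G$. Let $F$ be the set of pairs $(x,y)\in G\times G$ with $x\cap y\neq\emptyset$, $T(x)=x$ and $T(y)=y$. Then $\chi_{2,T}(G)=\sum_{(x,y)\in F} i_T(x,y)$, where $\chi_{2,T}(G)$ is the quadratic Lefschetz number and $i_T(x,y)=\omega(x)\,\omega(y)\,\mathrm{sign}(T|x)\,\mathrm{sign}(T|y)$.
   Context: A finite abstract simplicial complex $G$ is a finite set of non-empty finite sets closed under taking non-empty subsets; $\dim(x)=|x|-1$, $\omega(x)=(-1)^{\dim(x)}$, $q=\max_{x\in G}\dim(x)$. Fix an arbitrary ordering of the vertices of each $x\in G$. For $z\subset x$ with $\dim(z)=\dim(x)-1$, $\mathrm{sign}(x,z)$ is the signature of the permutation taking the tuple $(v,z)$, $v$ being the element of $x\setminus z$ followed by the ordered vertices of $z$, to the ordered tuple $x$. Let $\Lambda$ be the inner product space of real functions $f$ on the set of pairs $(x,y)\in G\times G$ with $x\cap y\ne\emptyset$ (extended by $0$ to non-intersecting pairs), and $\Lambda_k$ the subspace of functions supported on pairs with $\dim(x)+\dim(y)=k$, $0\le k\le 2q$. The exterior derivative is $df(x,y)=d_xf(x,y)+\omega(x)\,d_yf(x,y)$, where $d_xf(x,y)=\sum_{z\subset x,\dim z=\dim x-1}\mathrm{sign}(x,z)f(z,y)$ and $d_yf(x,y)=\sum_{z\subset y,\dim z=\dim y-1}\mathrm{sign}(y,z)f(x,z)$. Let $H=(d+d^* )^2$ and $H_k$ its restriction to $\Lambda_k$.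 An automorphism $T$ of $G$ is an invertible inclusion-preserving map $G\to G$ induced by a permutation of the vertices. $\mathrm{sign}(T|x)$ is the signature of the permutation taking $(T(x_0),\dots,T(x_n))$, for $x=(x_0,\dots,x_n)$ in its chosen order, to the chosen ordering of $T(x)$; if $T(x)=x$, it is the sign of the permutation induced by $T$ on $x$. The Koopman operator is $(Uf)(x,y)=\mathrm{sign}(T|x)\,\mathrm{sign}(T|y)\,f(T(x),T(y))$; it preserves each $\ker(H_k)$. The quadratic Lefschetz number is $\chi_{2,T}(G)=\sum_{k=0}^{2q}(-1)^k\,\mathrm{tr}(U|_{\ker(H_k)})$. *)

theory Defs
  imports Complex_Main "HOL-Combinatorics.Permutations" "HOL-Library.Function_Algebras"
begin

definition simplicial_complex :: "'a set set \<Rightarrow> bool" where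
  "simplicial_complex G \<longleftrightarrow>
     finite G \<and> (\<forall>x\<in>G. finite x \<and> x \<noteq> {}) \<and>
     (\<forall>x\<in>G. \<forall>y. y \<subseteq> x \<and> y \<noteq> {} \<longrightarrow> y \<in> G)"

definition sdim :: "'a set \<Rightarrow> nat" where
  "sdim x = card x - 1"

definition omega :: "'a set \<Rightarrow> real" where
  "omega x = (-1) ^ sdim x"

text \<open>For the empty complex this maximum is unspecified, which is harmless: then every space
  of forms below is zero.\<close>

definition max_dim :: "'a set set \<Rightarrow> nat" where
  "max_dim G = Max (sdim ` G)"

definition vertex_orders :: "'a set set \<Rightarrow> ('a set \<Rightarrow> 'a list) \<Rightarrow> bool" where
  "vertex_orders G ord \<longleftrightarrow> (\<forall>x\<in>G. distinct (ord x) \<and> set (ord x) = x)"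

text \<open>Signature of the permutation taking the tuple \<open>xs\<close> to the tuple \<open>ys\<close>, for two
  repetition-free tuples with the same entries.\<close>

definition tuple_sign :: "'a list \<Rightarrow> 'a list \<Rightarrow> real" where
  "tuple_sign xs ys = real_of_int (sign (THE p. p permutes set xs \<and> map p xs = ys))"

definition facets :: "'a set set \<Rightarrow> 'a set \<Rightarrow> 'a set set" where
  "facets G x = {z \<in> G. z \<subset> x \<and> sdim x = sdim z + 1}"

definition incidence :: "('a set \<Rightarrow> 'a list) \<Rightarrow> 'a set \<Rightarrow> 'a set \<Rightarrow> real" where
  "incidence ord x z = tuple_sign (the_elem (x - z) # ord z) (ord x)"

type_synonym 'a form = "'a set \<times> 'a set \<Rightarrow> real"

definition meeting_pairs :: "'a set set \<Rightarrow> ('a set \<times> 'a set) set" where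
  "meeting_pairs G = {(x, y). x \<in> G \<and> y \<in> G \<and> x \<inter> y \<noteq> {}}"

definition forms :: "'a set set \<Rightarrow> 'a form set" where
  "forms G = {f. \<forall>p. p \<notin> meeting_pairs G \<longrightarrow> f p = 0}"

definition forms_deg :: "'a set set \<Rightarrow> nat \<Rightarrow> 'a form set" where
  "forms_deg G k = {f \<in> forms G. \<forall>x y. f (x, y) \<noteq> 0 \<longrightarrow> sdim x + sdim y = k}"

definition form_inner :: "'a set set \<Rightarrow> 'a form \<Rightarrow> 'a form \<Rightarrow> real" where
  "form_inner G f g = (\<Sum>p\<in>meeting_pairs G. f p * g p)"

definition ext_dx :: "'a set set \<Rightarrow> ('a set \<Rightarrow> 'a list) \<Rightarrow> 'a form \<Rightarrow> 'a form" where
  "ext_dx G ord f = (\<lambda>(x, y). \<Sum>z\<in>facets G x. incidence ord x z * f (z, y))"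

definition ext_dy :: "'a set set \<Rightarrow> ('a set \<Rightarrow> 'a list) \<Rightarrow> 'a form \<Rightarrow> 'a form" where
  "ext_dy G ord f = (\<lambda>(x, y). \<Sum>z\<in>facets G y. incidence ord y z * f (x, z))"

definition ext_d :: "'a set set \<Rightarrow> ('a set \<Rightarrow> 'a list) \<Rightarrow> 'a form \<Rightarrow> 'a form" where
  "ext_d G ord f = (\<lambda>(x, y). if (x, y) \<in> meeting_pairs G
      then ext_dx G ord f (x, y) + omega x * ext_dy G ord f (x, y) else 0)"

definition form_adjoint :: "'a set set \<Rightarrow> ('a form \<Rightarrow> 'a form) \<Rightarrow> 'a form \<Rightarrow> 'a form" where
  "form_adjoint G A g =
     (THE h. h \<in> forms G \<and> (\<forall>f\<in>forms G. form_inner G (A f) g = form_inner G f h))"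

definition dirac :: "'a set set \<Rightarrow> ('a set \<Rightarrow> 'a list) \<Rightarrow> 'a form \<Rightarrow> 'a form" where
  "dirac G ord f = ext_d G ord f + form_adjoint G (ext_d G ord) f"

definition hodge :: "'a set set \<Rightarrow> ('a set \<Rightarrow> 'a list) \<Rightarrow> 'a form \<Rightarrow> 'a form" where
  "hodge G ord f = dirac G ord (dirac G ord f)"

definition ker_hodge :: "'a set set \<Rightarrow> ('a set \<Rightarrow> 'a list) \<Rightarrow> nat \<Rightarrow> 'a form set" where
  "ker_hodge G ord k = {f \<in> forms_deg G k. hodge G ord f = 0}"

text \<open>An automorphism is represented by the vertex permutation \<open>T\<close> inducing it; it acts on
  simplices by \<open>x \<mapsto> T ` x\<close>, which always preserves inclusions.\<close>

definition automorphism :: "'a set set \<Rightarrow> ('a \<Rightarrow> 'a) \<Rightarrow> bool" where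
  "automorphism G T \<longleftrightarrow> T permutes \<Union>G \<and> bij_betw (image T) G G"

definition aut_sign :: "('a set \<Rightarrow> 'a list) \<Rightarrow> ('a \<Rightarrow> 'a) \<Rightarrow> 'a set \<Rightarrow> real" where
  "aut_sign ord T x = tuple_sign (map T (ord x)) (ord (T ` x))"

definition koopman ::
    "'a set set \<Rightarrow> ('a set \<Rightarrow> 'a list) \<Rightarrow> ('a \<Rightarrow> 'a) \<Rightarrow> 'a form \<Rightarrow> 'a form" where
  "koopman G ord T f = (\<lambda>(x, y). if (x, y) \<in> meeting_pairs G
      then aut_sign ord T x * aut_sign ord T y * f (T ` x, T ` y) else 0)"

interpretation fun_vs: vector_space "\<lambda>(c::real) (f :: 'b \<Rightarrow> real) p. c * f p"
  by unfold_locales (auto simp: fun_eq_iff algebra_simps)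

text \<open>Trace of the restriction of a linear operator \<open>A\<close> to a finite-dimensional invariant
  subspace \<open>V\<close>: the sum of the diagonal matrix entries in some basis of \<open>V\<close>.\<close>

definition trace_on :: "('b \<Rightarrow> real) set \<Rightarrow> (('b \<Rightarrow> real) \<Rightarrow> ('b \<Rightarrow> real)) \<Rightarrow> real" where
  "trace_on V A =
     (let B = (SOME B. fun_vs.independent B \<and> fun_vs.span B = V)
      in \<Sum>b\<in>B. fun_vs.representation B (A b) b)"

definition quadratic_lefschetz ::
    "'a set set \<Rightarrow> ('a set \<Rightarrow> 'a list) \<Rightarrow> ('a \<Rightarrow> 'a) \<Rightarrow> real" where
  "quadratic_lefschetz G ord T =
     (\<Sum>k = 0..2 * max_dim G. (-1) ^ k * trace_on (ker_hodge G ord k) (koopman G ord T))"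

definition fixed_pairs :: "'a set set \<Rightarrow> ('a \<Rightarrow> 'a) \<Rightarrow> ('a set \<times> 'a set) set" where
  "fixed_pairs G T = {(x, y) \<in> meeting_pairs G. T ` x = x \<and> T ` y = y}"

definition pair_index ::
    "('a set \<Rightarrow> 'a list) \<Rightarrow> ('a \<Rightarrow> 'a) \<Rightarrow> 'a set \<Rightarrow> 'a set \<Rightarrow> real" where
  "pair_index ord T x y = omega x * omega y * aut_sign ord T x * aut_sign ord T y"

end

(* Let D = d + d*. It commutes with the Koopman operator U and anticommutes with the parity operator
   P = (-1)^degree, and the space of forms is the direct sum of ker D and the range R of D, because D
   is symmetric. On R the operator D is invertible, so the trace of P U on R equals that of
   D (P U) D^-1 = - P U and hence vanishes. Therefore the alternating sum of the traces of U on the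
   harmonic forms is the trace of P U on all forms, which in the basis of pairs of simplices is the
   sum of the indices of the fixed pairs. *)
theory Submission
  imports Defs
begin

subsection \<open>Signs of tuples\<close>

text \<open>\<open>trace_on\<close> refers to an unspecified basis of a subspace, and D is
  invertible only on its range. Every trace is therefore moved to coordinates: if P projects onto an
  invariant subspace, the trace of A there is the matrix trace of A after P in the basis indexed by
  pairs of simplices. Cyclicity is then needed only for square matrices over that index set, and
  D^-1 is replaced by a globally defined N that inverts D on its range and vanishes on ker D. D
  mixes neighbouring degrees, so it is not evident that ker D splits by degree. Here d^2 = 0 enters:
  it makes d f and d* f orthogonal, so D f = 0 forces both to vanish, and each of these two
  equations is homogeneous. That U commutes with d* is not checked on simplices; it follows from U
  being an isometry onto the space of forms that commutes with d. The combinatorial core is then d^2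
  = 0 and the compatibility of incidence signs with T.\<close>

lemma tuple_sign_eqI:
  assumes "p permutes set xs" "map p xs = ys"
  shows "tuple_sign xs ys = real_of_int (sign p)"
proof -
  have "(THE p. p permutes set xs \<and> map p xs = ys) = p"
  proof (rule the_equality)
    fix q assume q: "q permutes set xs \<and> map q xs = ys"
    then have "q x = p x" for x
      using assms by (cases "x \<in> set xs") (auto simp: permutes_not_in)
    then show "q = p" ..
  qed (use assms in simp)
  then show ?thesis by (simp add: tuple_sign_def)
qed

lemma ex_permutation_between_tuples:
  assumes "distinct xs" "distinct ys" "set xs = set ys"
  obtains p where "p permutes set xs" "map p xs = ys"
proof -
  have len: "length xs = length ys"
    using assms by (metis distinct_card)
  \<comment> \<open>\<open>f\<close> returns the position of an entry in \<open>xs\<close>;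
    \<open>p\<close> then picks the entry of \<open>ys\<close> at the same position.\<close>
  define f where "f = inv_into {..<length xs} ((!) xs)"
  define p where "p x = (if x \<in> set xs then ys ! f x else x)" for x
  have bx: "bij_betw ((!) xs) {..<length xs} (set xs)"
    using bij_betw_nth[OF assms(1)] by blast
  have bj: "bij_betw ((!) ys) {..<length xs} (set xs)"
    using bij_betw_nth[OF assms(2)] len assms(3) by auto
  have "bij_betw f (set xs) {..<length xs}"
    unfolding f_def by (rule bij_betw_inv_into[OF bx])
  then have "bij_betw ((!) ys \<circ> f) (set xs) (set xs)"
    by (rule bij_betw_trans[OF _ bj])
  then have "bij_betw p (set xs) (set xs)"
    by (rule bij_betw_cong[THEN iffD1, rotated]) (simp add: p_def)
  then have "p permutes set xs"
    by (rule bij_imp_permutes) (simp add: p_def)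
  moreover have "map p xs = ys"
  proof (rule nth_equalityI)
    fix i assume "i < length (map p xs)"
    then have "i < length xs" by simp
    moreover from this have "f (xs ! i) = i"
      unfolding f_def using bx by (intro inv_into_f_f) (auto simp: bij_betw_def)
    ultimately show "map p xs ! i = ys ! i" by (simp add: p_def)
  qed (simp add: len)
  ultimately show thesis by (rule that)
qed

text \<open>Cocycle rule: reordering in two stages composes the permutations, and the sign is
  multiplicative. Intermediate orderings thus cancel, which is the source of every identity between
  incidence numbers below.\<close>

lemma tuple_sign_mult:
  assumes "distinct xs" "distinct ys" "distinct zs" "set xs = set ys" "set ys = set zs"
  shows "tuple_sign xs ys * tuple_sign ys zs = tuple_sign xs zs"
proof -
  obtain p where p: "p permutes set xs" "map p xs = ys"
    using ex_permutation_between_tuples[OF assms(1,2,4)] .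
  obtain q where q: "q permutes set ys" "map q ys = zs"
    using ex_permutation_between_tuples[OF assms(2,3,5)] .
  have "q \<circ> p permutes set xs"
    using p(1) q(1) unfolding assms(4) by (rule permutes_compose)
  moreover have "map (q \<circ> p) xs = zs"
    using p(2) q(2) by auto
  ultimately have "tuple_sign xs zs = real_of_int (sign (q \<circ> p))"
    by (rule tuple_sign_eqI)
  moreover have "permutation p" "permutation q"
    using p(1) q(1) permutes_imp_permutation[OF finite_set] by blast+
  ultimately show ?thesis
    using tuple_sign_eqI[OF p] tuple_sign_eqI[OF q] by (simp add: sign_compose)
qed

lemma tuple_sign_square:
  assumes "distinct xs" "distinct ys" "set xs = set ys"
  shows "tuple_sign xs ys * tuple_sign xs ys = 1"
proof -
  obtain p where "p permutes set xs" "map p xs = ys"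
    using ex_permutation_between_tuples[OF assms] .
  then have "tuple_sign xs ys = real_of_int (sign p)"
    by (rule tuple_sign_eqI)
  then show ?thesis
    by (simp flip: of_int_mult)
qed

text \<open>The permutation of the tails fixes \<open>v\<close>, so the same permutation serves both
  pairs of tuples.\<close>

lemma tuple_sign_Cons:
  assumes "distinct xs" "distinct ys" "set xs = set ys" "v \<notin> set xs"
  shows "tuple_sign (v # xs) (v # ys) = tuple_sign xs ys"
proof -
  obtain p where p: "p permutes set xs" "map p xs = ys"
    using ex_permutation_between_tuples[OF assms(1,2,3)] .
  have "p permutes set (v # xs)" "map p (v # xs) = v # ys"
    using p assms(4) by (auto intro: permutes_imp_permutes_insert simp: permutes_not_in)
  then have "tuple_sign (v # xs) (v # ys) = real_of_int (sign p)"
    by (rule tuple_sign_eqI)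
  then show ?thesis
    using tuple_sign_eqI[OF p] by simp
qed

lemma tuple_sign_transpose:
  assumes "distinct (a # b # xs)"
  shows "tuple_sign (a # b # xs) (b # a # xs) = -1"
proof -
  have "transpose a b permutes set (a # b # xs)"
    by (intro permutes_swap_id) auto
  moreover have "map (transpose a b) (a # b # xs) = b # a # xs"
    using assms by (auto intro!: map_idI transpose_apply_other)
  ultimately have "tuple_sign (a # b # xs) (b # a # xs) = real_of_int (sign (transpose a b))"
    by (rule tuple_sign_eqI)
  then show ?thesis
    using assms by (simp add: sign_swap_id)
qed

text \<open>Relabelling the entries by \<open>f\<close> conjugates the permutation, which leaves its
  sign unchanged.\<close>

lemma tuple_sign_map:
  assumes "distinct xs" "distinct ys" "set xs = set ys" "inj_on f (set xs)"
  shows "tuple_sign (map f xs) (map f ys) = tuple_sign xs ys"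
proof -
  obtain p where p: "p permutes set xs" "map p xs = ys"
    using ex_permutation_between_tuples[OF assms(1,2,3)] .
  have "map_permutation (set xs) f p permutes set (map f xs)"
    using map_permutation_permutes[OF _ p(1), of f "f ` set xs"] assms(4)
    by (simp add: inj_on_imp_bij_betw)
  moreover have "map (map_permutation (set xs) f p) (map f xs) = map f ys"
    using p assms(4) by (auto simp: map_permutation_apply)
  ultimately have "tuple_sign (map f xs) (map f ys)
      = real_of_int (sign (map_permutation (set xs) f p))"
    by (rule tuple_sign_eqI)
  then show ?thesis
    using tuple_sign_eqI[OF p] p assms(4) by (simp add: sign_map_permutation)
qed

subsection \<open>Traces of operators on finitely supported functions\<close>

abbreviation fscale :: "real \<Rightarrow> ('b \<Rightarrow> real) \<Rightarrow> 'b \<Rightarrow> real" where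
  "fscale \<equiv> \<lambda>c f p. c * f p"

abbreviation linear_op :: "(('b \<Rightarrow> real) \<Rightarrow> ('b \<Rightarrow> real)) \<Rightarrow> bool" where
  "linear_op \<equiv> Vector_Spaces.linear fscale fscale"

interpretation fun_pair: vector_space_pair fscale fscale
  by unfold_locales

lemma linear_opI:
  assumes "\<And>f h. A (f + h) = A f + A h" "\<And>c f. A (\<lambda>p. c * f p) = (\<lambda>p. c * A f p)"
  shows "linear_op A"
  by unfold_locales (simp_all add: assms)

lemma sum_fun_apply: "(\<Sum>i\<in>I. F i) p = (\<Sum>i\<in>I. F i p)"
  for F :: "'i \<Rightarrow> 'b \<Rightarrow> real"
  by (induction I rule: infinite_finite_induct) auto

text \<open>A copy of the coordinate space R^M inside the full function type, on which
  \<open>fun_vs\<close> lives. For finite \<open>M\<close> it is spanned by the functions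
  \<open>unit_at p\<close>.\<close>

definition supported :: "'b set \<Rightarrow> ('b \<Rightarrow> real) set" where
  "supported M = {f. \<forall>p. p \<notin> M \<longrightarrow> f p = 0}"

definition unit_at :: "'b \<Rightarrow> 'b \<Rightarrow> real" where
  "unit_at p = (\<lambda>q. if q = p then 1 else 0)"

definition inner_on :: "'b set \<Rightarrow> ('b \<Rightarrow> real) \<Rightarrow> ('b \<Rightarrow> real) \<Rightarrow> real" where
  "inner_on M f h = (\<Sum>p\<in>M. f p * h p)"

definition op_trace :: "'b set \<Rightarrow> (('b \<Rightarrow> real) \<Rightarrow> ('b \<Rightarrow> real)) \<Rightarrow> real" where
  "op_trace M A = (\<Sum>p\<in>M. A (unit_at p) p)"

lemma subspace_supported: "fun_vs.subspace (supported M)"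
  by (auto simp: fun_vs.subspace_def supported_def)

lemma unit_at_supported: "p \<in> M \<Longrightarrow> unit_at p \<in> supported M"
  by (auto simp: supported_def unit_at_def)

lemma supported_expand:
  assumes "finite M" "f \<in> supported M"
  shows "f = (\<Sum>p\<in>M. (\<lambda>q. f p * unit_at p q))"
proof
  fix q
  have "(\<Sum>p\<in>M. f p * unit_at p q) = (\<Sum>p\<in>M. if q = p then f p else 0)"
    by (rule sum.cong) (auto simp: unit_at_def)
  then show "f q = (\<Sum>p\<in>M. (\<lambda>q. f p * unit_at p q)) q"
    using assms by (auto simp: sum_fun_apply supported_def)
qed

lemma linear_op_expand:
  assumes "finite M" "linear_op A" "f \<in> supported M"
  shows "A f = (\<Sum>p\<in>M. (\<lambda>q. f p * A (unit_at p) q))"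
proof -
  have "A f = A (\<Sum>p\<in>M. (\<lambda>q. f p * unit_at p q))"
    using supported_expand[OF assms(1,3)] by simp
  also have "\<dots> = (\<Sum>p\<in>M. A (\<lambda>q. f p * unit_at p q))"
    using fun_pair.linear_sum[OF assms(2)] .
  also have "\<dots> = (\<Sum>p\<in>M. (\<lambda>q. f p * A (unit_at p) q))"
    using fun_pair.linear_scale[OF assms(2)] by simp
  finally show ?thesis .
qed

lemma linear_op_expand_at:
  assumes "finite M" "linear_op A" "f \<in> supported M"
  shows "A f q = (\<Sum>p\<in>M. f p * A (unit_at p) q)"
proof -
  have "A f q = (\<Sum>p\<in>M. (\<lambda>q. f p * A (unit_at p) q)) q"
    using linear_op_expand[OF assms] by (rule fun_cong)
  also have "\<dots> = (\<Sum>p\<in>M. f p * A (unit_at p) q)"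
    by (rule sum_fun_apply)
  finally show ?thesis .
qed

text \<open>Both traces are the same double sum of products of matrix entries. Invariance of the
  support is needed so that the inner value can be expanded over \<open>M\<close>.\<close>

lemma op_trace_commute:
  assumes "finite M" "linear_op A" "linear_op B"
    and "A ` supported M \<subseteq> supported M" "B ` supported M \<subseteq> supported M"
  shows "op_trace M (\<lambda>f. A (B f)) = op_trace M (\<lambda>f. B (A f))"
proof -
  have *: "op_trace M (\<lambda>f. A (B f)) = (\<Sum>p\<in>M. \<Sum>q\<in>M. B (unit_at p) q * A (unit_at q) p)"
    if "linear_op A" "B ` supported M \<subseteq> supported M" for A B :: "('a \<Rightarrow> real) \<Rightarrow> ('a \<Rightarrow> real)"
    unfolding op_trace_def
  proof (rule sum.cong)
    fix p assume "p \<in> M"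
    then have "B (unit_at p) \<in> supported M"
      by (intro subsetD[OF that(2)] imageI unit_at_supported)
    then show "A (B (unit_at p)) p = (\<Sum>q\<in>M. B (unit_at p) q * A (unit_at q) p)"
      by (rule linear_op_expand_at[OF assms(1) that(1)])
  qed simp
  show ?thesis
    unfolding *[OF assms(2,5)] *[OF assms(3,4)]
    by (subst sum.swap) (simp add: mult.commute)
qed

lemma supported_span: "finite M \<Longrightarrow> supported M \<subseteq> fun_vs.span (unit_at ` M)"
proof
  fix f :: "'a \<Rightarrow> real" assume "finite M" "f \<in> supported M"
  then have "f = (\<Sum>p\<in>M. (\<lambda>q. f p * unit_at p q))"
    by (rule supported_expand)
  also have "\<dots> \<in> fun_vs.span (unit_at ` M)"
    by (intro fun_vs.span_sum fun_vs.span_scale fun_vs.span_base imageI)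
  finally show "f \<in> fun_vs.span (unit_at ` M)" .
qed

lemma finite_independent_supported:
  assumes "finite M" "fun_vs.independent B" "B \<subseteq> supported M"
  shows "finite B"
  using fun_vs.independent_span_bound[of "unit_at ` M" B] assms supported_span by blast

text \<open>Cyclicity for rectangular matrices: with the inclusion of \<open>V\<close> into R^M and
  \<open>A\<close> after \<open>P\<close> as a map from R^M to \<open>V\<close>, composing in one
  order gives \<open>A\<close> on \<open>V\<close>, in the other \<open>A\<close> after
  \<open>P\<close> on R^M. Any projection onto \<open>V\<close> will do, and the result does not
  depend on the basis chosen by \<open>SOME\<close>.\<close>

lemma trace_on_eq_op_trace:
  assumes fin: "finite M" and V: "fun_vs.subspace V" "V \<subseteq> supported M"
    and A: "linear_op A" "A ` V \<subseteq> V"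
    and P: "linear_op P" "P ` supported M \<subseteq> V" "\<And>f. f \<in> V \<Longrightarrow> P f = f"
  shows "trace_on V A = op_trace M (\<lambda>f. A (P f))"
proof -
  define B where "B = (SOME B. fun_vs.independent B \<and> fun_vs.span B = V)"
  have "\<exists>B. fun_vs.independent B \<and> fun_vs.span B = V"
    using fun_vs.maximal_independent_subset[of V] V(1)
    by (metis fun_vs.span_subspace)
  then have "fun_vs.independent B \<and> fun_vs.span B = V"
    unfolding B_def by (rule someI_ex)
  then have B: "fun_vs.independent B" "fun_vs.span B = V"
    by simp_all
  have BV: "B \<subseteq> V" using B(2) fun_vs.span_superset by blast
  have finB: "finite B"
    using finite_independent_supported[OF fin B(1)] BV V(2) by blast
  have AP: "linear_op (\<lambda>f. A (P f))"
    using Vector_Spaces.linear_compose[OF P(1) A(1)] by (simp add: o_def)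
  let ?r = "fun_vs.representation B"
  have in_V: "A (P (unit_at p)) \<in> fun_vs.span B" if "p \<in> M" for p
    unfolding B(2) using that by (intro subsetD[OF A(2)] subsetD[OF P(2)] imageI unit_at_supported)
  have "trace_on V A = (\<Sum>b\<in>B. ?r (A b) b)"
    unfolding trace_on_def Let_def B_def ..
  also have "\<dots> = (\<Sum>b\<in>B. \<Sum>p\<in>M. b p * ?r (A (P (unit_at p))) b)"
  proof (rule sum.cong)
    fix b assume b: "b \<in> B"
    then have "A b = A (P b)" using BV P(3) by auto
    also have "\<dots> = (\<Sum>p\<in>M. (\<lambda>q. b p * A (P (unit_at p)) q))"
      using linear_op_expand[OF fin AP, of b] b BV V(2) by blast
    finally have "?r (A b) = (\<lambda>c. \<Sum>p\<in>M. ?r (\<lambda>q. b p * A (P (unit_at p)) q) c)"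
      using in_V by (simp only: fun_vs.representation_sum[OF B(1)] fun_vs.span_scale)
    then show "?r (A b) b = (\<Sum>p\<in>M. b p * ?r (A (P (unit_at p))) b)"
      using in_V by (simp add: fun_vs.representation_scale[OF B(1)])
  qed simp
  also have "\<dots> = (\<Sum>p\<in>M. \<Sum>b\<in>B. ?r (A (P (unit_at p))) b * b p)"
    by (subst sum.swap) (simp add: mult.commute)
  also have "\<dots> = (\<Sum>p\<in>M. A (P (unit_at p)) p)"
  proof (rule sum.cong)
    fix p assume "p \<in> M"
    then have "(\<Sum>b\<in>B. (\<lambda>q. ?r (A (P (unit_at p))) b * b q)) = A (P (unit_at p))"
      using in_V by (intro fun_vs.sum_representation_eq[OF B(1) _ finB order.refl])
    from fun_cong[OF this, of p]
    show "(\<Sum>b\<in>B. ?r (A (P (unit_at p))) b * b p) = A (P (unit_at p)) p"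
      by (simp add: sum_fun_apply)
  qed simp
  finally show ?thesis by (simp add: op_trace_def)
qed

text \<open>Dimension count: if the image of a basis \<open>B\<close> missed some \<open>v\<close>
  in \<open>V\<close>, adjoining \<open>v\<close> would give \<open>card B + 1\<close> independent
  vectors inside the span of \<open>B\<close>.\<close>

lemma inj_linear_op_onto:
  assumes "finite M" "fun_vs.subspace V" "V \<subseteq> supported M"
    and A: "linear_op A" "A ` V \<subseteq> V" "inj_on A V"
  shows "A ` V = V"
proof -
  obtain B where B: "B \<subseteq> V" "fun_vs.independent B" "fun_vs.span B = V"
    using fun_vs.maximal_independent_subset[of V] assms(2) by (metis fun_vs.span_subspace)
  have finB: "finite B" using finite_independent_supported[OF assms(1) B(2)] B(1) assms(3) by blast
  have ind: "fun_vs.independent (A ` B)"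
    using fun_pair.linear_independent_injective_image[OF A(1) B(2)] A(3) B(3) by simp
  have sub: "A ` B \<subseteq> V" using B(1) A(2) by blast
  have cardAB: "card (A ` B) = card B"
    using A(3) B(1) by (metis card_image inj_on_subset)
  have "V \<subseteq> fun_vs.span (A ` B)"
  proof (rule ccontr)
    assume "\<not> V \<subseteq> fun_vs.span (A ` B)"
    then obtain v where v: "v \<in> V" "v \<notin> fun_vs.span (A ` B)" by blast
    then have "fun_vs.independent (insert v (A ` B))"
      using ind by (intro fun_vs.independent_insertI)
    then have "card (insert v (A ` B)) \<le> card B"
      using fun_vs.independent_span_bound[OF finB] v(1) sub B(3) by blast
    moreover have "v \<notin> A ` B" using v(2) fun_vs.span_base by blast
    ultimately show False using finB cardAB by simp
  qed
  also have "\<dots> = A ` V"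
    using fun_pair.linear_span_image[OF A(1), of B] B(3) by simp
  finally show ?thesis using A(2) by blast
qed

subsection \<open>The Lefschetz formula for a finite graded complex\<close>

definition degree_part :: "('b \<Rightarrow> nat) \<Rightarrow> nat \<Rightarrow> ('b \<Rightarrow> real) \<Rightarrow> 'b \<Rightarrow> real" where
  "degree_part g k f = (\<lambda>p. if g p = k then f p else 0)"

definition parity :: "('b \<Rightarrow> nat) \<Rightarrow> ('b \<Rightarrow> real) \<Rightarrow> 'b \<Rightarrow> real" where
  "parity g f = (\<lambda>p. (-1) ^ g p * f p)"

lemma linear_op_degree_part: "linear_op (degree_part g k)"
  by (rule linear_opI) (auto simp: degree_part_def fun_eq_iff)

lemma linear_op_parity: "linear_op (parity g)"
  by (rule linear_opI) (auto simp: parity_def fun_eq_iff algebra_simps)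

lemma degree_part_supported: "f \<in> supported M \<Longrightarrow> degree_part g k f \<in> supported M"
  by (simp add: supported_def degree_part_def)

lemma parity_supported: "f \<in> supported M \<Longrightarrow> parity g f \<in> supported M"
  by (simp add: supported_def parity_def)

lemma degree_part_parity: "degree_part g k (parity g f) = (\<lambda>p. (-1) ^ k * degree_part g k f p)"
  by (auto simp: degree_part_def parity_def)

section \<open>The Euclidean inner product on finitely supported functions\<close>

lemma inner_on_commute: "inner_on M f h = inner_on M h f"
  by (simp add: inner_on_def mult.commute)

lemma inner_on_add_right: "inner_on M f (h + k) = inner_on M f h + inner_on M f k"
  by (simp add: inner_on_def sum.distrib algebra_simps)

lemma inner_on_zero_right [simp]: "inner_on M f 0 = 0"
  by (simp add: inner_on_def)

lemma inner_on_uminus_right: "inner_on M f (- h) = - inner_on M f h"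
  by (simp add: inner_on_def sum_negf)

lemma inner_on_parity: "inner_on M (parity g f) h = inner_on M f (parity g h)"
  by (simp add: inner_on_def parity_def mult_ac)

lemma inner_on_degree_part: "inner_on M (degree_part g k f) h = inner_on M f (degree_part g k h)"
  unfolding inner_on_def degree_part_def by (rule sum.cong) auto

lemma inner_on_unit_right: "finite M \<Longrightarrow> p \<in> M \<Longrightarrow> inner_on M f (unit_at p) = f p"
  by (simp add: inner_on_def unit_at_def if_distrib sum.delta cong: if_cong)

lemma inner_on_self_eq_0:
  assumes "finite M" "f \<in> supported M" "inner_on M f f = 0"
  shows "f = 0"
proof
  fix p
  have "\<forall>p\<in>M. f p * f p = 0"
    using assms(1,3) unfolding inner_on_def by (subst (asm) sum_nonneg_eq_0_iff) auto
  then show "f p = 0 p"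
    using assms(2) by (cases "p \<in> M") (auto simp: supported_def)
qed

text \<open>Nondegeneracy of the inner product: adjoint identities are proved by testing against all
  \<open>h\<close>, and uniqueness of adjoints also rests on it.\<close>

lemma supported_eqI:
  assumes "finite M" "f \<in> supported M" "f' \<in> supported M"
    and "\<And>h. h \<in> supported M \<Longrightarrow> inner_on M h f = inner_on M h f'"
  shows "f = f'"
proof
  fix p
  show "f p = f' p"
  proof (cases "p \<in> M")
    case True
    have "inner_on M f (unit_at p) = inner_on M f' (unit_at p)"
      using assms(4)[OF unit_at_supported[OF True]]
      by (simp only: inner_on_commute[of M f] inner_on_commute[of M f'])
    then show ?thesis
      using assms(1) True by (simp add: inner_on_unit_right)
  next
    case False
    then show ?thesis using assms(2,3) by (simp add: supported_def)
  qed
qed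

text \<open>A finite-dimensional cochain complex with an isometric, degree-preserving cochain map
  \<open>U\<close>, where \<open>g\<close> grades the basis \<open>M\<close> and \<open>d'\<close>
  is the adjoint of \<open>d\<close>. That \<open>d\<close> raises degree by one takes two
  conditions, since \<open>Suc k\<close> never reaches degree 0.\<close>

locale lefschetz_complex =
  fixes M :: "'b set" and g :: "'b \<Rightarrow> nat" and d d' U :: "('b \<Rightarrow> real) \<Rightarrow> ('b \<Rightarrow> real)"
  assumes finite_M: "finite M"
    and lin_d: "linear_op d" and lin_d': "linear_op d'" and lin_U: "linear_op U"
    and d_supported: "f \<in> supported M \<Longrightarrow> d f \<in> supported M"
    and d'_supported: "f \<in> supported M \<Longrightarrow> d' f \<in> supported M"
    and U_supported: "f \<in> supported M \<Longrightarrow> U f \<in> supported M"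
    and adjoint: "\<lbrakk>f \<in> supported M; h \<in> supported M\<rbrakk> \<Longrightarrow> inner_on M (d f) h = inner_on M f (d' h)"
    and d_d: "f \<in> supported M \<Longrightarrow> d (d f) = 0"
    and degree_part_Suc_d: "f \<in> supported M \<Longrightarrow> degree_part g (Suc k) (d f) = d (degree_part g k f)"
    and degree_part_0_d: "f \<in> supported M \<Longrightarrow> degree_part g 0 (d f) = 0"
    and U_d: "f \<in> supported M \<Longrightarrow> U (d f) = d (U f)"
    and U_isometry: "\<lbrakk>f \<in> supported M; h \<in> supported M\<rbrakk> \<Longrightarrow> inner_on M (U f) (U h) = inner_on M f h"
    and U_degree_part: "f \<in> supported M \<Longrightarrow> U (degree_part g k f) = degree_part g k (U f)"
begin

section \<open>Relations between the differential, its adjoint, parity and U\<close>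

definition D :: "('b \<Rightarrow> real) \<Rightarrow> ('b \<Rightarrow> real)" where
  "D f = d f + d' f"

text \<open>An isometry is injective, hence onto in finite dimension. This lets every test form be
  written as \<open>U h'\<close> when the adjoint of \<open>d\<close> is compared with
  \<open>U\<close>.\<close>

lemma U_onto: "U ` supported M = supported M"
proof (rule inj_linear_op_onto[OF finite_M subspace_supported order.refl lin_U])
  show "U ` supported M \<subseteq> supported M" using U_supported by (rule image_subsetI)
  have "f = 0" if "f \<in> supported M" "U f = 0" for f
    using U_isometry[OF that(1,1)] that by (intro inner_on_self_eq_0[OF finite_M]) simp_all
  then show "inj_on U (supported M)"
    unfolding fun_pair.linear_inj_on_iff_eq_0[OF lin_U subspace_supported] by simp
qed

lemma add_supported: "\<lbrakk>f \<in> supported M; h \<in> supported M\<rbrakk> \<Longrightarrow> f + h \<in> supported M"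
  by (rule fun_vs.subspace_add[OF subspace_supported])

lemma D_supported: "f \<in> supported M \<Longrightarrow> D f \<in> supported M"
  unfolding D_def by (intro add_supported d_supported d'_supported)

lemma linear_D: "linear_op D"
  unfolding D_def[abs_def] by (rule fun_pair.linear_compose_add[OF lin_d lin_d'])

lemma uminus_supported: "f \<in> supported M \<Longrightarrow> - f \<in> supported M"
  by (rule fun_vs.subspace_neg[OF subspace_supported])

text \<open>At a point of degree \<open>k + 1\<close> only the degree \<open>k\<close> part of
  \<open>f\<close> contributes to \<open>d f\<close>, so the two signs differ by one factor -1; at
  degree 0 both sides vanish.\<close>

lemma parity_d: assumes "f \<in> supported M" shows "d (parity g f) = - parity g (d f)"
proof
  fix p
  note sf = parity_supported[OF assms, of g]
  have at: "h p = degree_part g (g p) h p" for h by (simp add: degree_part_def)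
  show "d (parity g f) p = (- parity g (d f)) p"
  proof (cases "g p")
    case 0
    then show ?thesis
      using at[of "d (parity g f)"] at[of "d f"] degree_part_0_d[OF sf] degree_part_0_d[OF assms]
      by (simp add: parity_def)
  next
    case (Suc k)
    have "d (parity g f) p = d (degree_part g k (parity g f)) p"
      using at[of "d (parity g f)"] degree_part_Suc_d[OF sf, of k] Suc by simp
    also have "\<dots> = (-1) ^ k * d (degree_part g k f) p"
      unfolding degree_part_parity using fun_pair.linear_scale[OF lin_d] by simp
    also have "d (degree_part g k f) p = d f p"
      using at[of "d f"] degree_part_Suc_d[OF assms, of k] Suc by simp
    finally show ?thesis using Suc by (simp add: parity_def)
  qed
qed

text \<open>The adjoint of \<open>parity_d\<close>, as parity is self-adjoint.\<close>

lemma parity_d': assumes "f \<in> supported M" shows "d' (parity g f) = - parity g (d' f)"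
proof (rule supported_eqI[OF finite_M])
  note sf = parity_supported[OF assms, of g]
  show "d' (parity g f) \<in> supported M" "- parity g (d' f) \<in> supported M"
    using assms by (simp_all add: sf d'_supported uminus_supported parity_supported)
  fix h assume h: "h \<in> supported M"
  note sh = parity_supported[OF h, of g]
  have "inner_on M h (d' (parity g f)) = inner_on M (d h) (parity g f)"
    using adjoint[OF h sf] by simp
  also have "\<dots> = inner_on M f (parity g (d h))"
    by (metis inner_on_parity inner_on_commute)
  also have "\<dots> = - inner_on M f (d (parity g h))"
    by (simp only: parity_d[OF h] inner_on_uminus_right minus_minus)
  also have "\<dots> = - inner_on M (parity g h) (d' f)"
    using adjoint[OF sh assms] by (simp only: inner_on_commute)
  also have "\<dots> = inner_on M h (- parity g (d' f))"
    by (simp only: inner_on_parity inner_on_uminus_right)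
  finally show "inner_on M h (d' (parity g f)) = inner_on M h (- parity g (d' f))" .
qed

lemma parity_D: "f \<in> supported M \<Longrightarrow> D (parity g f) = - parity g (D f)"
  using fun_pair.linear_add[OF linear_op_parity[of g]] by (simp add: D_def parity_d parity_d')

text \<open>Testing against \<open>U h'\<close> and cancelling the isometry \<open>U\<close> moves
  the claim to \<open>d\<close>, where commutation is an axiom.\<close>

lemma U_d': assumes "f \<in> supported M" shows "U (d' f) = d' (U f)"
proof (rule supported_eqI[OF finite_M])
  show "U (d' f) \<in> supported M" "d' (U f) \<in> supported M"
    using assms by (simp_all add: U_supported d'_supported)
  fix h assume "h \<in> supported M"
  then obtain h' where h': "h' \<in> supported M" "h = U h'"
    using U_onto by (metis imageE)
  have "inner_on M h (U (d' f)) = inner_on M h' (d' f)"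
    unfolding h'(2) by (rule U_isometry[OF h'(1) d'_supported[OF assms]])
  also have "\<dots> = inner_on M (d h') f" by (rule adjoint[OF h'(1) assms, symmetric])
  also have "\<dots> = inner_on M (d (U h')) (U f)"
    using U_isometry[OF d_supported[OF h'(1)] assms] U_d[OF h'(1)] by simp
  also have "\<dots> = inner_on M h (d' (U f))"
    unfolding h'(2) by (rule adjoint[OF U_supported[OF h'(1)] U_supported[OF assms]])
  finally show "inner_on M h (U (d' f)) = inner_on M h (d' (U f))" .
qed

lemma U_D: "f \<in> supported M \<Longrightarrow> U (D f) = D (U f)"
  using fun_pair.linear_add[OF lin_U] by (simp add: D_def U_d U_d')

section \<open>Harmonic forms and their grading\<close>

lemma D_symmetric:
  assumes "f \<in> supported M" "h \<in> supported M"
  shows "inner_on M (D f) h = inner_on M f (D h)"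
proof -
  have "inner_on M (D f) h = inner_on M (d f) h + inner_on M h (d' f)"
    unfolding D_def by (metis inner_on_add_right inner_on_commute)
  also have "\<dots> = inner_on M f (d' h) + inner_on M (d h) f"
    using adjoint[OF assms] adjoint[OF assms(2,1)] by simp
  also have "\<dots> = inner_on M f (D h)"
    unfolding D_def by (metis inner_on_add_right inner_on_commute add.commute)
  finally show ?thesis .
qed

text \<open>By symmetry the inner product of \<open>f\<close> with \<open>D (D f)\<close> is the
  squared norm of \<open>D f\<close>.\<close>

lemma D_D_eq_0_iff: assumes "f \<in> supported M" shows "D (D f) = 0 \<longleftrightarrow> D f = 0"
proof
  assume "D (D f) = 0"
  then have "inner_on M (D f) (D f) = 0"
    using D_symmetric[OF assms D_supported[OF assms]] by simp
  then show "D f = 0"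
    by (rule inner_on_self_eq_0[OF finite_M D_supported[OF assms]])
next
  assume "D f = 0" then show "D (D f) = 0"
    using fun_pair.linear_0[OF linear_D] by simp
qed

text \<open>\<open>d f\<close> and \<open>d' f\<close> are orthogonal because
  \<open>d (d f) = 0\<close>; hence the squared norm of \<open>d f\<close> is its inner product with
  \<open>D f\<close>.\<close>

lemma D_eq_0_iff: assumes "f \<in> supported M" shows "D f = 0 \<longleftrightarrow> d f = 0 \<and> d' f = 0"
proof
  assume 0: "D f = 0"
  have "inner_on M (d f) (d' f) = inner_on M (d (d f)) f"
    using adjoint[OF d_supported[OF assms] assms] by simp
  then have orth: "inner_on M (d f) (d' f) = 0"
    using d_d[OF assms] inner_on_commute[of M 0 f] by simp
  have "inner_on M (d f) (d f) = inner_on M (d f) (D f)"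
    unfolding D_def inner_on_add_right using orth by simp
  then have df: "d f = 0"
    using 0 by (intro inner_on_self_eq_0[OF finite_M d_supported[OF assms]]) simp
  with 0 show "d f = 0 \<and> d' f = 0" by (simp add: D_def)
qed (simp add: D_def)

text \<open>\<open>D\<close> does not respect degrees, but \<open>d f = 0\<close> and
  \<open>d' f = 0\<close> hold separately, and each passes to homogeneous parts. For
  \<open>d'\<close> this is seen by moving the degree projection onto \<open>d h\<close>.\<close>

lemma D_degree_part_eq_0:
  assumes f: "f \<in> supported M" and 0: "D f = 0"
  shows "D (degree_part g k f) = 0"
proof -
  have d: "d f = 0" and d': "d' f = 0" using D_eq_0_iff[OF f] 0 by simp_all
  note sf = degree_part_supported[OF f, of g k]
  have "d (degree_part g k f) = 0"
    using degree_part_Suc_d[OF f, of k] d fun_pair.linear_0[OF linear_op_degree_part[of g "Suc k"]]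
    by simp
  moreover have "d' (degree_part g k f) = 0"
  proof (rule supported_eqI[OF finite_M d'_supported[OF sf]])
    show "0 \<in> supported M" by (simp add: supported_def)
    fix h assume h: "h \<in> supported M"
    have "inner_on M h (d' (degree_part g k f)) = inner_on M (d h) (degree_part g k f)"
      using adjoint[OF h sf] by simp
    also have "\<dots> = inner_on M (degree_part g k (d h)) f"
      by (rule inner_on_degree_part[symmetric])
    also have "\<dots> = 0"
    proof (cases k)
      case 0
      then show ?thesis using degree_part_0_d[OF h] inner_on_commute[of M 0 f] by simp
    next
      case (Suc m)
      then show ?thesis
        using degree_part_Suc_d[OF h, of m] adjoint[OF degree_part_supported[OF h] f] d' by simp
    qed
    finally show "inner_on M h (d' (degree_part g k f)) = inner_on M h 0" by simp
  qed
  ultimately show ?thesis by (simp add: D_def)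
qed

definition harmonic :: "nat \<Rightarrow> ('b \<Rightarrow> real) set" where
  "harmonic k = {f \<in> supported M. degree_part g k f = f \<and> D (D f) = 0}"

lemma subspace_harmonic: "fun_vs.subspace (harmonic k)"
proof -
  have "f + h \<in> harmonic k" if "f \<in> harmonic k" "h \<in> harmonic k" for f h
    using that fun_pair.linear_add[OF linear_D] fun_pair.linear_add[OF linear_op_degree_part[of g k]]
    by (simp add: harmonic_def add_supported)
  moreover have "(\<lambda>p. c * f p) \<in> harmonic k" if "f \<in> harmonic k" for c f
    using that fun_pair.linear_scale[OF linear_D]
      fun_pair.linear_scale[OF linear_op_degree_part[of g k]]
    by (simp add: harmonic_def zero_fun_def fun_vs.subspace_scale[OF subspace_supported])
  moreover have "0 \<in> harmonic k"
    using fun_pair.linear_0[OF linear_D] fun_pair.linear_0[OF linear_op_degree_part[of g k]]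
    by (simp add: harmonic_def supported_def)
  ultimately show ?thesis by (simp add: fun_vs.subspace_def)
qed

lemma harmonic_D: "f \<in> harmonic k \<Longrightarrow> D f = 0"
  using D_D_eq_0_iff by (auto simp: harmonic_def)

lemma U_harmonic: "U ` harmonic k \<subseteq> harmonic k"
proof
  fix h assume "h \<in> U ` harmonic k"
  then obtain f where h: "h = U f" and f: "f \<in> harmonic k" by (rule imageE)
  have "f \<in> supported M" using f by (simp add: harmonic_def)
  then have "D (D (U f)) = U (D (D f))"
    by (simp add: U_D D_supported U_supported)
  then show "h \<in> harmonic k"
    using f fun_pair.linear_0[OF lin_U] U_degree_part[of f k] by (simp add: harmonic_def h U_supported)
qed

text \<open>Since \<open>D\<close> is symmetric, it is bijective on its own range \<open>R\<close>; inverting it there yields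
  the projection \<open>\<rho>\<close> onto \<open>R\<close> along \<open>ker D\<close> together with a parametrix \<open>N\<close>.\<close>

lemma ex_parametrix:
  "\<exists>\<rho> N. linear_op \<rho> \<and> linear_op N \<and>
    (\<forall>f\<in>supported M. \<rho> f \<in> supported M \<and> N f \<in> supported M \<and> D (\<rho> f) = D f \<and>
      (D f = 0 \<longrightarrow> \<rho> f = 0) \<and> N (D f) = \<rho> f \<and> D (N f) = \<rho> f)"
proof -
  define R where "R = D ` supported M"
  have RM: "R \<subseteq> supported M" unfolding R_def using D_supported by (rule image_subsetI)
  have subR: "fun_vs.subspace R"
    unfolding R_def by (rule fun_pair.linear_subspace_image[OF linear_D subspace_supported])
  have DR: "D ` R \<subseteq> R" using RM unfolding R_def by (rule image_mono)
  have "r = 0" if r: "r \<in> R" "D r = 0" for r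
  proof -
    obtain f where f: "f \<in> supported M" "r = D f" using r(1) unfolding R_def by (rule imageE)
    then show "r = 0" using r(2) D_D_eq_0_iff[OF f(1)] by simp
  qed
  then have inj: "inj_on D R"
    unfolding fun_pair.linear_inj_on_iff_eq_0[OF linear_D subR] by simp
  obtain h where h: "h ` UNIV \<subseteq> R" "linear_op h" "\<forall>r\<in>R. h (D r) = r"
    using fun_pair.linear_exists_left_inverse_on[OF linear_D subR inj] by (elim exE conjE)
  have onto: "D ` R = R"
    by (rule inj_linear_op_onto[OF finite_M subR RM linear_D DR inj])
  have hR: "h f \<in> R" for f using h(1) by (rule subsetD) simp
  have Dh: "D (h r) = r" if r: "r \<in> R" for r
  proof -
    have "r \<in> D ` R" using r onto by simp
    then obtain s where "s \<in> R" "r = D s" by (elim imageE) simp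
    then show ?thesis using h(3) by simp
  qed
  have inR: "D f \<in> R" if "f \<in> supported M" for f
    unfolding R_def using that by (rule imageI)
  have lin: "linear_op (\<lambda>f. h (D f))"
    using Vector_Spaces.linear_compose[OF linear_D h(2)] by (simp add: o_def)
  have linN: "linear_op (\<lambda>f. h (h (D f)))"
    using Vector_Spaces.linear_compose[OF lin h(2)] by (simp add: o_def)
  \<comment> \<open>Off \<open>R\<close> the left inverse \<open>h\<close> is only known to land in
    \<open>R\<close>. Applying it after \<open>h (D f)\<close>, instead of directly to
    \<open>f\<close>, makes \<open>N\<close> vanish on the kernel of \<open>D\<close> and gives
    \<open>D (N f) = \<rho> f\<close> for every form \<open>f\<close>.\<close>
  show ?thesis
  proof (rule exI[of _ "\<lambda>f. h (D f)"], rule exI[of _ "\<lambda>f. h (h (D f))"], intro conjI ballI lin linN)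
    fix f assume f: "f \<in> supported M"
    show "h (D f) \<in> supported M" "h (h (D f)) \<in> supported M"
      by (rule subsetD[OF RM hR])+
    show eq: "D (h (D f)) = D f" by (rule Dh[OF inR[OF f]])
    show "D f = 0 \<longrightarrow> h (D f) = 0"
      using fun_pair.linear_0[OF h(2)] by simp
    show "h (h (D (D f))) = h (D f)"
      using h(3) inR[OF f] by simp
    show "D (h (h (D f))) = h (D f)" by (rule Dh[OF hR])
  qed
qed

theorem alternating_trace_harmonic:
  assumes bound: "\<And>p. p \<in> M \<Longrightarrow> g p \<le> n"
  shows "(\<Sum>k=0..n. (-1) ^ k * trace_on (harmonic k) U) = (\<Sum>p\<in>M. (-1) ^ g p * U (unit_at p) p)"
proof -
  obtain \<rho> N where lin\<rho>: "linear_op \<rho>" and linN: "linear_op N"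
    and par: "\<forall>f\<in>supported M. \<rho> f \<in> supported M \<and> N f \<in> supported M \<and> D (\<rho> f) = D f \<and>
      (D f = 0 \<longrightarrow> \<rho> f = 0) \<and> N (D f) = \<rho> f \<and> D (N f) = \<rho> f"
    using ex_parametrix by (elim exE conjE)
  have \<rho>M: "\<rho> f \<in> supported M" and NM: "N f \<in> supported M" and D\<rho>: "D (\<rho> f) = D f"
    and \<rho>0: "D f = 0 \<Longrightarrow> \<rho> f = 0" and ND: "N (D f) = \<rho> f" and DN: "D (N f) = \<rho> f"
    if "f \<in> supported M" for f
    using par that by simp_all
  define W where "W f = parity g (U f)" for f
  have WM: "W f \<in> supported M" if "f \<in> supported M" for f
    unfolding W_def using that by (intro parity_supported U_supported)
  have linW: "linear_op W"
    using Vector_Spaces.linear_compose[OF lin_U linear_op_parity[of g]]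
    by (simp add: W_def[abs_def] o_def)
  have WD: "W (D f) = - D (W f)" if "f \<in> supported M" for f
    unfolding W_def using that by (simp add: U_D parity_D U_supported)
  \<comment> \<open>\<open>N\<close> stands in for the inverse of \<open>D\<close>: W \<rho> = W N D
    has the trace of D W N = - W D N = - W \<rho>.\<close>
  have "op_trace M (\<lambda>f. W (\<rho> f)) = op_trace M (\<lambda>f. W (N (D f)))"
    unfolding op_trace_def by (rule sum.cong) (simp_all add: ND unit_at_supported)
  also have "\<dots> = op_trace M (\<lambda>f. D (W (N f)))"
    using op_trace_commute[OF finite_M Vector_Spaces.linear_compose[OF linN linW] linear_D]
      NM WM D_supported by (simp add: image_subset_iff)
  also have "\<dots> = op_trace M (\<lambda>f. - W (D (N f)))"
    unfolding op_trace_def by (rule sum.cong) (simp_all add: WD NM unit_at_supported)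
  also have "\<dots> = - op_trace M (\<lambda>f. W (\<rho> f))"
    unfolding op_trace_def sum_negf[symmetric]
    by (rule sum.cong) (simp_all add: DN unit_at_supported)
  finally have range0: "op_trace M (\<lambda>f. W (\<rho> f)) = 0" by simp
  \<comment> \<open>The complementary projection, onto the kernel of \<open>D\<close> along its
    range; followed by \<open>degree_part g k\<close> it projects onto
    \<open>harmonic k\<close>.\<close>
  define \<pi> where "\<pi> f = f - \<rho> f" for f
  have lin\<pi>: "linear_op \<pi>"
    unfolding \<pi>_def[abs_def]
    using fun_pair.linear_compose_sub[OF fun_vs.linear_id[unfolded id_def] lin\<rho>] .
  have \<pi>M: "\<pi> f \<in> supported M" if "f \<in> supported M" for f
    unfolding \<pi>_def using that \<rho>M by (intro fun_vs.subspace_diff[OF subspace_supported]) simp_all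
  have D\<pi>: "D (\<pi> f) = 0" if "f \<in> supported M" for f
    unfolding \<pi>_def using fun_pair.linear_diff[OF linear_D] D\<rho>[OF that] by simp
  have tr: "trace_on (harmonic k) U = op_trace M (\<lambda>f. U (degree_part g k (\<pi> f)))" for k
  proof (rule trace_on_eq_op_trace[OF finite_M subspace_harmonic _ lin_U U_harmonic])
    show "harmonic k \<subseteq> supported M" by (auto simp: harmonic_def)
    show "linear_op (\<lambda>f. degree_part g k (\<pi> f))"
      using Vector_Spaces.linear_compose[OF lin\<pi> linear_op_degree_part[of g k]] by (simp add: o_def)
    show "(\<lambda>f. degree_part g k (\<pi> f)) ` supported M \<subseteq> harmonic k"
    proof (rule image_subsetI)
      fix f assume f: "f \<in> supported M"
      have "D (degree_part g k (\<pi> f)) = 0"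
        by (rule D_degree_part_eq_0[OF \<pi>M[OF f] D\<pi>[OF f]])
      moreover have "degree_part g k (degree_part g k (\<pi> f)) = degree_part g k (\<pi> f)"
        by (simp add: degree_part_def fun_eq_iff)
      ultimately show "degree_part g k (\<pi> f) \<in> harmonic k"
        using fun_pair.linear_0[OF linear_D] degree_part_supported[OF \<pi>M[OF f]]
        by (simp add: harmonic_def)
    qed
    show "degree_part g k (\<pi> f) = f" if "f \<in> harmonic k" for f
      using \<rho>0[OF _ harmonic_D[OF that]] that by (simp add: \<pi>_def harmonic_def)
  qed
  have "(\<Sum>k=0..n. (-1) ^ k * trace_on (harmonic k) U)
      = (\<Sum>p\<in>M. \<Sum>k=0..n. (-1) ^ k * U (degree_part g k (\<pi> (unit_at p))) p)"
    unfolding tr op_trace_def sum_distrib_left by (rule sum.swap)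
  also have "\<dots> = (\<Sum>p\<in>M. W (\<pi> (unit_at p)) p)"
  proof (rule sum.cong)
    fix p assume p: "p \<in> M"
    \<comment> \<open>\<open>U\<close> commutes with the degree projections, so at \<open>p\<close>
      only the summand \<open>k = g p\<close> survives. It lies in the range of summation by
      \<open>bound\<close>, and its sign is the parity factor in \<open>W\<close>.\<close>
    have "(\<Sum>k=0..n. (-1) ^ k * U (degree_part g k (\<pi> (unit_at p))) p)
        = (\<Sum>k=0..n. if g p = k then (-1) ^ k * U (\<pi> (unit_at p)) p else 0)"
      using U_degree_part[OF \<pi>M[OF unit_at_supported[OF p]]]
      by (intro sum.cong) (simp_all add: degree_part_def)
    then show "(\<Sum>k=0..n. (-1) ^ k * U (degree_part g k (\<pi> (unit_at p))) p) = W (\<pi> (unit_at p)) p"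
      using bound[OF p] by (simp add: W_def parity_def)
  qed simp
  also have "\<dots> = op_trace M W - op_trace M (\<lambda>f. W (\<rho> f))"
    unfolding op_trace_def \<pi>_def using fun_pair.linear_diff[OF linW] by (simp add: sum_subtractf)
  also have "\<dots> = (\<Sum>p\<in>M. (-1) ^ g p * U (unit_at p) p)"
    unfolding range0 by (simp add: op_trace_def W_def parity_def)
  finally show ?thesis .
qed

end

subsection \<open>Facets and incidence numbers\<close>

lemma simplicial_complexD:
  assumes "simplicial_complex G"
  shows "finite G" "x \<in> G \<Longrightarrow> finite x" "x \<in> G \<Longrightarrow> x \<noteq> {}"
    "\<lbrakk>x \<in> G; y \<subseteq> x; y \<noteq> {}\<rbrakk> \<Longrightarrow> y \<in> G"
  using assms unfolding simplicial_complex_def by blast+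

lemma vertex_ordersD:
  assumes "vertex_orders G ord" "x \<in> G"
  shows "distinct (ord x)" "set (ord x) = x"
  using assms by (simp_all add: vertex_orders_def)

lemma facetsE:
  assumes "simplicial_complex G" "x \<in> G" "z \<in> facets G x"
  obtains v where "v \<notin> z" "x = insert v z" "z \<in> G" "z \<noteq> {}"
proof -
  have z: "z \<in> G" "z \<subset> x" "sdim x = sdim z + 1"
    using assms(3) by (auto simp: facets_def)
  then have fin: "finite x" "finite z" "z \<noteq> {}"
    using simplicial_complexD[OF assms(1)] assms(2) by simp_all
  \<comment> \<open>Nonemptiness excludes the truncated case of \<open>card z - 1\<close> in
    \<open>sdim\<close>, so equality of dimensions up to one becomes a statement on
    cardinalities.\<close>
  then have "card z > 0" by (simp add: card_gt_0_iff)
  then have "card (x - z) = 1"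
    using z fin by (simp add: sdim_def card_Diff_subset psubset_imp_subset)
  then obtain v where "x - z = {v}" by (rule card_1_singletonE)
  then have "v \<notin> z" "x = insert v z" using z(2) by blast+
  then show thesis using z(1) fin(3) by (rule that)
qed

lemma facets_insertI:
  assumes "simplicial_complex G" "insert v z \<in> G" "v \<notin> z" "z \<noteq> {}"
  shows "z \<in> facets G (insert v z)"
proof -
  have fin: "finite z" using simplicial_complexD(2)[OF assms(1,2)] by simp
  then have "card z > 0" using assms(4) by (simp add: card_gt_0_iff)
  moreover have "z \<in> G" using simplicial_complexD(4)[OF assms(1,2) _ assms(4)] by blast
  ultimately show ?thesis using assms(3) fin by (auto simp: facets_def sdim_def)
qed

lemma finite_facets: "simplicial_complex G \<Longrightarrow> finite (facets G x)"
  by (simp add: facets_def simplicial_complexD(1))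

lemma facets_subset: "facets G x \<subseteq> G"
  by (auto simp: facets_def)

lemma sdim_facet: "z \<in> facets G x \<Longrightarrow> sdim x = Suc (sdim z)"
  by (simp add: facets_def)

lemma omega_facet: "z \<in> facets G x \<Longrightarrow> omega x = - omega z"
  by (simp add: facets_def omega_def)

lemma incidence_insert:
  "v \<notin> z \<Longrightarrow> incidence ord (insert v z) z = tuple_sign (v # ord z) (ord (insert v z))"
  by (simp add: incidence_def insert_Diff_if)

text \<open>Prefixing \<open>a\<close> to both orderings of \<open>insert b w\<close> keeps the
  sign, and then that intermediate ordering cancels by the cocycle rule.\<close>

lemma incidence_mult_insert:
  assumes ord: "vertex_orders G ord" and G: "w \<in> G" "insert b w \<in> G" "insert a (insert b w) \<in> G"
    and ab: "a \<noteq> b" "a \<notin> w" "b \<notin> w"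
  shows "incidence ord (insert a (insert b w)) (insert b w) * incidence ord (insert b w) w
    = tuple_sign (a # b # ord w) (ord (insert a (insert b w)))"
proof -
  let ?x = "insert a (insert b w)"
  have w: "distinct (ord w)" "set (ord w) = w"
    and bw: "distinct (ord (insert b w))" "set (ord (insert b w)) = insert b w"
    and x: "distinct (ord ?x)" "set (ord ?x) = ?x"
    using G by (simp_all add: vertex_ordersD[OF ord])
  have "tuple_sign (b # ord w) (ord (insert b w))
      = tuple_sign (a # b # ord w) (a # ord (insert b w))"
    using w bw ab by (subst tuple_sign_Cons) simp_all
  moreover have "tuple_sign (a # b # ord w) (a # ord (insert b w)) * tuple_sign (a # ord (insert b w)) (ord ?x)
      = tuple_sign (a # b # ord w) (ord ?x)"
    using w bw x ab by (intro tuple_sign_mult) simp_all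
  ultimately show ?thesis
    using ab by (simp add: incidence_insert mult.commute)
qed

text \<open>The two ways of descending from the simplex to \<open>w\<close> compare with tuples that
  differ by exchanging \<open>a\<close> and \<open>b\<close>.\<close>

lemma incidence_mult_swap:
  assumes ord: "vertex_orders G ord" and G: "w \<in> G" "insert a w \<in> G" "insert b w \<in> G"
      "insert a (insert b w) \<in> G"
    and ab: "a \<noteq> b" "a \<notin> w" "b \<notin> w"
  shows "incidence ord (insert a (insert b w)) (insert b w) * incidence ord (insert b w) w
    = - (incidence ord (insert a (insert b w)) (insert a w) * incidence ord (insert a w) w)"
proof -
  let ?x = "insert a (insert b w)"
  have w: "distinct (ord w)" "set (ord w) = w" and x: "distinct (ord ?x)" "set (ord ?x) = ?x"
    using G by (simp_all add: vertex_ordersD[OF ord])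
  have comm: "insert b (insert a w) = ?x" by (rule insert_commute)
  have "tuple_sign (a # b # ord w) (b # a # ord w) * tuple_sign (b # a # ord w) (ord ?x)
      = tuple_sign (a # b # ord w) (ord ?x)"
    using w x ab by (intro tuple_sign_mult) auto
  moreover have "tuple_sign (a # b # ord w) (b # a # ord w) = -1"
    using w ab by (intro tuple_sign_transpose) simp
  moreover have "incidence ord ?x (insert b w) * incidence ord (insert b w) w
      = tuple_sign (a # b # ord w) (ord ?x)"
    by (rule incidence_mult_insert[OF ord G(1,3,4) ab])
  moreover have "incidence ord ?x (insert a w) * incidence ord (insert a w) w
      = tuple_sign (b # a # ord w) (ord ?x)"
    using incidence_mult_insert[OF ord G(1,2), of b] G(4) ab unfolding comm by simp
  ultimately show ?thesis by simp
qed

text \<open>The square of a one-variable differential vanishes: exactly two simplices lie between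
  \<open>w\<close> and \<open>x\<close>, and exchanging them is a sign-reversing involution on the
  chains.\<close>

lemma sum_facets_facets:
  assumes G: "simplicial_complex G" and ord: "vertex_orders G ord" and x: "x \<in> G"
  shows "(\<Sum>z\<in>facets G x. \<Sum>w\<in>facets G z. incidence ord x z * (incidence ord z w * \<phi> w)) = 0"
proof -
  let ?S = "Sigma (facets G x) (facets G)"
  define F where "F = (\<lambda>(z, w). incidence ord x z * (incidence ord z w * \<phi> w))"
  \<comment> \<open>With x = z + a and z = w + b, the set \<open>x - z\<close> is {a}, so the
    intermediate simplex w + b is replaced by w + a.\<close>
  define i where "i = (\<lambda>(z, w). (w \<union> (x - z), w))"
  have i: "i p \<in> ?S" "i (i p) = p" "F (i p) = - F p" if "p \<in> ?S" for p
  proof -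
    obtain z w where p: "p = (z, w)" by (cases p)
    have z: "z \<in> facets G x" and w: "w \<in> facets G z" using that p by auto
    obtain a where a: "a \<notin> z" "x = insert a z" "z \<in> G"
      using facetsE[OF G x z] by metis
    obtain b where b: "b \<notin> w" "z = insert b w" "w \<in> G" "w \<noteq> {}"
      using facetsE[OF G a(3) w] by metis
    have x_eq: "x = insert a (insert b w)" "x = insert b (insert a w)" and ab: "a \<noteq> b" "a \<notin> w"
      using a b by auto
    have ip: "i p = (insert a w, w)" using x_eq(1) ab b(1,2) p by (auto simp: i_def)
    have aw: "insert a w \<in> G"
      by (rule simplicial_complexD(4)[OF G x]) (use x_eq(2) in auto)
    have "insert a w \<in> facets G x"
      unfolding x_eq(2) by (rule facets_insertI[OF G]) (use x x_eq(2) ab b(1) in auto)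
    moreover have "w \<in> facets G (insert a w)"
      using G aw ab(2) b(4) by (rule facets_insertI)
    ultimately show "i p \<in> ?S" by (simp add: ip)
    show "i (i p) = p" using ab b(1,2) by (auto simp: ip p i_def x_eq(1))
    have "incidence ord x (insert a w) * incidence ord (insert a w) w
        = - (incidence ord x z * incidence ord z w)"
      using incidence_mult_swap[OF ord b(3) aw, of b] a(3) x ab b(1) unfolding b(2) x_eq(1) by simp
    then show "F (i p) = - F p"
      unfolding ip by (simp add: p F_def flip: mult.assoc)
  qed
  have "sum F ?S = (\<Sum>p\<in>?S. - F p)"
    by (rule sum.reindex_bij_witness[of _ i i]) (use i in auto)
  then have "sum F ?S = 0" by (simp add: sum_negf)
  moreover have "(\<Sum>z\<in>facets G x. \<Sum>w\<in>facets G z. incidence ord x z * (incidence ord z w * \<phi> w)) = sum F ?S"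
    unfolding F_def by (rule sum.Sigma) (simp_all add: finite_facets[OF G])
  ultimately show ?thesis by simp
qed

section \<open>Automorphisms acting on facets and incidence numbers\<close>

lemma automorphism_inj: "automorphism G T \<Longrightarrow> inj T"
  by (auto simp: automorphism_def intro: permutes_inj)

lemma automorphism_image: "automorphism G T \<Longrightarrow> x \<in> G \<Longrightarrow> T ` x \<in> G"
  unfolding automorphism_def by (meson bij_betwE)

lemma aut_sign_square:
  assumes "vertex_orders G ord" "automorphism G T" "x \<in> G"
  shows "aut_sign ord T x * aut_sign ord T x = 1"
  unfolding aut_sign_def
  using assms(3) automorphism_image[OF assms(2,3)]
    inj_on_subset[OF automorphism_inj[OF assms(2)] subset_UNIV, of x]
  by (intro tuple_sign_square) (simp_all add: vertex_ordersD[OF assms(1)] distinct_map)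

text \<open>Both sides compare two routes from the image of \<open>v # ord z\<close> to
  \<open>ord (T\<close> x)\<open>: through the image of\<close>ord
  x\<open>, or through the chosen order of\<close>T \<open>z\<close> with \<open>T v\<close> in
  front.\<close>

lemma incidence_image:
  assumes G: "simplicial_complex G" and ord: "vertex_orders G ord" and T: "automorphism G T"
    and x: "x \<in> G" and z: "z \<in> facets G x"
  shows "aut_sign ord T x * incidence ord (T ` x) (T ` z) = incidence ord x z * aut_sign ord T z"
proof -
  obtain v where v: "v \<notin> z" "x = insert v z" "z \<in> G" using facetsE[OF G x z] by metis
  note inj = automorphism_inj[OF T]
  have Tx: "T ` x = insert (T v) (T ` z)" "T v \<notin> T ` z"
    using v inj by (auto dest: injD)
  have ox: "distinct (ord x)" "set (ord x) = x" and oz: "distinct (ord z)" "set (ord z) = z"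
    and oTx: "distinct (ord (T ` x))" "set (ord (T ` x)) = T ` x"
    and oTz: "distinct (ord (T ` z))" "set (ord (T ` z)) = T ` z"
    using x v(3) automorphism_image[OF T] by (simp_all add: vertex_ordersD[OF ord])
  define a where "a = map T (v # ord z)"
  define b where "b = map T (ord x)"
  define c where "c = ord (T ` x)"
  define e where "e = T v # ord (T ` z)"
  have dist: "distinct a" "distinct b" "distinct c" "distinct e"
    using v(1) inj ox oz oTx oTz Tx(2)
    by (auto simp: a_def b_def c_def e_def distinct_map inj_on_def inj_def)
  have sets: "set a = T ` x" "set b = T ` x" "set c = T ` x" "set e = T ` x"
    using v(2) ox oz oTx oTz Tx(1) by (auto simp: a_def b_def c_def e_def)
  have inc: "incidence ord x z = tuple_sign a b"
  proof -
    have "tuple_sign a b = tuple_sign (v # ord z) (ord x)"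
      unfolding a_def b_def
    proof (rule tuple_sign_map)
      show "inj_on T (set (v # ord z))" using inj by (rule inj_on_subset) simp
    qed (use ox oz v(1,2) in auto)
    then show ?thesis using v(1,2) by (simp add: incidence_insert)
  qed
  have autz: "aut_sign ord T z = tuple_sign a e"
    unfolding aut_sign_def a_def e_def list.map
    using oz oTz Tx(2) inj_on_subset[OF inj subset_UNIV, of z]
    by (subst tuple_sign_Cons) (simp_all add: distinct_map)
  have incT: "incidence ord (T ` x) (T ` z) = tuple_sign e c"
    unfolding e_def c_def Tx(1) by (rule incidence_insert[OF Tx(2)])
  have autx: "aut_sign ord T x = tuple_sign b c"
    by (simp add: aut_sign_def b_def c_def)
  have 1: "tuple_sign a b * tuple_sign b c = tuple_sign a c"
    and 2: "tuple_sign a e * tuple_sign e c = tuple_sign a c"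
    using dist sets by (auto intro!: tuple_sign_mult)
  have 3: "tuple_sign a b * tuple_sign a b = 1" and 4: "tuple_sign e c * tuple_sign e c = 1"
    using dist sets by (auto intro!: tuple_sign_square)
  \<comment> \<open>The routes a, b, c and a, e, c give equal products; since the factors square to
    1, they can be moved across the equation.\<close>
  have "tuple_sign b c * tuple_sign e c
      = (tuple_sign a b * tuple_sign a b) * (tuple_sign b c * tuple_sign e c)"
    using 3 by simp
  also have "\<dots> = tuple_sign a b * (tuple_sign a c * tuple_sign e c)"
    unfolding 1[symmetric] by (simp only: mult_ac)
  also have "\<dots> = tuple_sign a b * (tuple_sign a e * (tuple_sign e c * tuple_sign e c))"
    unfolding 2[symmetric] by (simp only: mult_ac)
  finally show ?thesis
    unfolding 4 autx incT inc autz by simp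
qed

lemma facets_image:
  assumes G: "simplicial_complex G" and T: "automorphism G T" and x: "x \<in> G"
  shows "facets G (T ` x) = image T ` facets G x"
proof
  note inj = automorphism_inj[OF T]
  have card: "sdim (T ` y) = sdim y" for y
    unfolding sdim_def using card_image[OF inj_on_subset[OF inj subset_UNIV], of y] by simp
  show "image T ` facets G x \<subseteq> facets G (T ` x)"
    using automorphism_image[OF T] inj by (auto simp: facets_def card inj_image_subset_iff psubset_eq inj_image_eq_iff)
  show "facets G (T ` x) \<subseteq> image T ` facets G x"
  proof
    fix u assume u: "u \<in> facets G (T ` x)"
    then have "u \<in> image T ` G" using T by (auto simp: facets_def automorphism_def bij_betw_def)
    then obtain z where "z \<in> G" "u = T ` z" by blast
    then show "u \<in> image T ` facets G x"
      using u inj by (auto simp: facets_def card psubset_eq inj_image_subset_iff inj_image_eq_iff)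
  qed
qed

subsection \<open>Quadratic forms\<close>

lemma forms_eq_supported: "forms G = supported (meeting_pairs G)"
  by (simp add: forms_def supported_def)

lemma form_inner_eq_inner_on: "form_inner G = inner_on (meeting_pairs G)"
  by (simp add: form_inner_def inner_on_def fun_eq_iff)

lemma finite_meeting_pairs: "simplicial_complex G \<Longrightarrow> finite (meeting_pairs G)"
  by (rule finite_subset[of _ "G \<times> G"]) (auto simp: meeting_pairs_def simplicial_complexD(1))

text \<open>Testing against \<open>unit_at p\<close> dictates the value of the adjoint at
  \<open>p\<close>. This explicit form settles existence, nondegeneracy settles uniqueness, and
  linearity can be read off.\<close>

lemma form_adjoint_eq:
  assumes G: "simplicial_complex G" and A: "linear_op A"
  shows "form_adjoint G A h =
    (\<lambda>p. if p \<in> meeting_pairs G then form_inner G (A (unit_at p)) h else 0)"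
    and "f \<in> forms G \<Longrightarrow> form_inner G (A f) h = form_inner G f (form_adjoint G A h)"
proof -
  let ?M = "meeting_pairs G"
  note fin = finite_meeting_pairs[OF G]
  define k where "k = (\<lambda>p. if p \<in> ?M then form_inner G (A (unit_at p)) h else 0)"
  have k: "k \<in> forms G" by (simp add: k_def forms_def)
  have adj: "form_inner G (A f) h = form_inner G f k" if "f \<in> forms G" for f
  proof -
    have "form_inner G (A f) h = (\<Sum>q\<in>?M. \<Sum>p\<in>?M. f p * A (unit_at p) q * h q)"
      unfolding form_inner_def
      using linear_op_expand_at[OF fin A that[unfolded forms_eq_supported]]
      by (simp add: sum_distrib_right)
    also have "\<dots> = (\<Sum>p\<in>?M. \<Sum>q\<in>?M. f p * A (unit_at p) q * h q)"
      by (rule sum.swap)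
    also have "\<dots> = form_inner G f k"
      unfolding form_inner_def k_def by (simp add: sum_distrib_left mult.assoc)
    finally show ?thesis .
  qed
  have eq: "form_adjoint G A h = k"
    unfolding form_adjoint_def
  proof (rule the_equality)
    fix k' assume k': "k' \<in> forms G \<and> (\<forall>f\<in>forms G. form_inner G (A f) h = form_inner G f k')"
    show "k' = k"
      using k k' adj unfolding forms_eq_supported form_inner_eq_inner_on
      by (intro supported_eqI[OF fin]) simp_all
  qed (use k adj in simp)
  show "form_adjoint G A h =
    (\<lambda>p. if p \<in> meeting_pairs G then form_inner G (A (unit_at p)) h else 0)"
    unfolding eq k_def ..
  show "form_inner G (A f) h = form_inner G f (form_adjoint G A h)" if "f \<in> forms G"
    unfolding eq by (rule adj[OF that])
qed

lemma linear_op_form_adjoint: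
  assumes "simplicial_complex G" "linear_op A"
  shows "linear_op (form_adjoint G A)"
  unfolding form_adjoint_eq(1)[OF assms, abs_def]
  by (rule linear_opI)
    (auto simp: form_inner_def fun_eq_iff sum.distrib distrib_left distrib_right sum_distrib_left mult_ac)

section \<open>The differential and the Koopman operator on quadratic forms\<close>

lemma linear_op_ext_d: "linear_op (ext_d G ord)"
  by (rule linear_opI)
    (auto simp: ext_d_def ext_dx_def ext_dy_def fun_eq_iff sum.distrib distrib_left
      sum_distrib_left mult_ac)

lemma linear_op_koopman: "linear_op (koopman G ord T)"
  by (rule linear_opI) (auto simp: koopman_def fun_eq_iff algebra_simps)

lemma ext_d_in_forms: "ext_d G ord f \<in> forms G"
  by (auto simp: ext_d_def forms_def)

lemma koopman_in_forms: "koopman G ord T f \<in> forms G"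
  by (auto simp: koopman_def forms_def)

lemma form_eq_0: "f \<in> forms G \<Longrightarrow> x \<inter> y = {} \<Longrightarrow> f (x, y) = 0"
  by (simp add: forms_def meeting_pairs_def)

text \<open>The cutoff to meeting pairs is harmless: if \<open>x\<close> and \<open>y\<close> are
  disjoint, so are their facets from the other simplex, and every summand is already 0. Iterating
  \<open>ext_d\<close> then needs no case distinction on intersections.\<close>

lemma ext_d_apply:
  assumes f: "f \<in> forms G" and xy: "x \<in> G" "y \<in> G"
  shows "ext_d G ord f (x, y) = (\<Sum>z\<in>facets G x. incidence ord x z * f (z, y)) +
    omega x * (\<Sum>z\<in>facets G y. incidence ord y z * f (x, z))"
proof (cases "x \<inter> y = {}")
  case True
  have "f (z, y) = 0" if "z \<in> facets G x" for z
    using that True by (intro form_eq_0[OF f]) (auto simp: facets_def)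
  moreover have "f (x, z) = 0" if "z \<in> facets G y" for z
    using that True by (intro form_eq_0[OF f]) (auto simp: facets_def)
  ultimately show ?thesis
    using True by (simp add: ext_d_def meeting_pairs_def)
next
  case False
  then show ?thesis using xy by (simp add: ext_d_def ext_dx_def ext_dy_def meeting_pairs_def)
qed

lemma koopman_apply:
  assumes T: "automorphism G T" and f: "f \<in> forms G" and xy: "x \<in> G" "y \<in> G"
  shows "koopman G ord T f (x, y) = aut_sign ord T x * aut_sign ord T y * f (T ` x, T ` y)"
proof (cases "x \<inter> y = {}")
  case True
  then have "T ` x \<inter> T ` y = {}"
    by (simp add: image_Int[OF automorphism_inj[OF T], symmetric])
  then show ?thesis
    using True by (simp add: koopman_def meeting_pairs_def form_eq_0[OF f])
next
  case False
  then show ?thesis using xy by (simp add: koopman_def meeting_pairs_def)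
qed

text \<open>The pure terms vanish by \<open>sum_facets_facets\<close>. The mixed terms occur twice
  and cancel, because passing from \<open>x\<close> to a facet flips \<open>omega\<close>; this is
  what the factor \<open>omega x\<close> in the differential is for.\<close>

lemma ext_d_ext_d:
  assumes G: "simplicial_complex G" and ord: "vertex_orders G ord" and f: "f \<in> forms G"
  shows "ext_d G ord (ext_d G ord f) = 0"
proof
  fix p :: "'a set \<times> 'a set"
  obtain x y where p: "p = (x, y)" by (cases p)
  let ?d = "ext_d G ord" and ?i = "incidence ord"
  show "?d (?d f) p = 0 p"
  proof (cases "x \<in> G \<and> y \<in> G")
    case False
    then show ?thesis by (auto simp: p ext_d_def meeting_pairs_def)
  next
    case True
    then have x: "x \<in> G" and y: "y \<in> G" by simp_all
    have zG: "z \<in> G" if "z \<in> facets G u" for z u using that facets_subset by blast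
    have A: "(\<Sum>z\<in>facets G x. ?i x z * ?d f (z, y))
      = (\<Sum>z\<in>facets G x. \<Sum>w\<in>facets G z. ?i x z * (?i z w * f (w, y)))
        - omega x * (\<Sum>z\<in>facets G x. \<Sum>u\<in>facets G y. ?i x z * (?i y u * f (z, u)))"
      unfolding sum_distrib_left sum_subtractf[symmetric]
    proof (rule sum.cong)
      fix z assume z: "z \<in> facets G x"
      show "?i x z * ?d f (z, y) = (\<Sum>w\<in>facets G z. ?i x z * (?i z w * f (w, y)))
        - (\<Sum>u\<in>facets G y. omega x * (?i x z * (?i y u * f (z, u))))"
        unfolding ext_d_apply[OF f zG[OF z] y] omega_facet[OF z] distrib_left sum_distrib_left
        by (simp add: sum_negf mult_ac)
    qed simp
    have B: "(\<Sum>u\<in>facets G y. ?i y u * ?d f (x, u))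
      = (\<Sum>z\<in>facets G x. \<Sum>u\<in>facets G y. ?i x z * (?i y u * f (z, u)))
        + omega x * (\<Sum>u\<in>facets G y. \<Sum>w\<in>facets G u. ?i y u * (?i u w * f (x, w)))"
    proof -
      have "(\<Sum>z\<in>facets G x. \<Sum>u\<in>facets G y. ?i x z * (?i y u * f (z, u)))
        = (\<Sum>u\<in>facets G y. \<Sum>z\<in>facets G x. ?i x z * (?i y u * f (z, u)))"
        by (rule sum.swap)
      then show ?thesis
        unfolding sum_distrib_left
        by (simp only: sum.distrib[symmetric])
          (rule sum.cong, simp_all add: ext_d_apply[OF f x zG] distrib_left sum_distrib_left mult_ac)
    qed
    show ?thesis
      unfolding p ext_d_apply[OF ext_d_in_forms x y] A B
        sum_facets_facets[OF G ord x] sum_facets_facets[OF G ord y]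
      by simp
  qed
qed

text \<open>\<open>T\<close> carries the facets of a simplex to those of its image, so the sums can
  be reindexed; \<open>incidence_image\<close> then matches them term by term, and
  \<open>omega\<close> is invariant.\<close>

lemma ext_d_koopman:
  assumes G: "simplicial_complex G" and ord: "vertex_orders G ord" and T: "automorphism G T"
    and f: "f \<in> forms G"
  shows "koopman G ord T (ext_d G ord f) = ext_d G ord (koopman G ord T f)"
proof
  fix p :: "'a set \<times> 'a set"
  obtain x y where p: "p = (x, y)" by (cases p)
  let ?d = "ext_d G ord" and ?i = "incidence ord" and ?U = "koopman G ord T" and ?s = "aut_sign ord T"
  note inj = automorphism_inj[OF T]
  show "?U (?d f) p = ?d (?U f) p"
  proof (cases "x \<in> G \<and> y \<in> G")
    case False
    then show ?thesis by (auto simp: p ext_d_def koopman_def meeting_pairs_def)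
  next
    case True
    then have x: "x \<in> G" and y: "y \<in> G" by simp_all
    have zG: "z \<in> G" if "z \<in> facets G u" for z u using that facets_subset by blast
    have reindex: "(\<Sum>z\<in>facets G (T ` u). ?i (T ` u) z * h z)
        = (\<Sum>z\<in>facets G u. ?i (T ` u) (T ` z) * h (T ` z))" if "u \<in> G" for u h
      unfolding facets_image[OF G T that]
      by (subst sum.reindex) (simp_all add: inj_on_def inj_image_eq_iff[OF inj])
    have omega: "omega (T ` x) = omega x"
      unfolding omega_def sdim_def using card_image[OF inj_on_subset[OF inj subset_UNIV], of x] by simp
    have A: "?s x * ?s y * (\<Sum>z\<in>facets G (T ` x). ?i (T ` x) z * f (z, T ` y))
        = (\<Sum>z\<in>facets G x. ?i x z * ?U f (z, y))"
      unfolding reindex[OF x] sum_distrib_left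
    proof (rule sum.cong)
      fix z assume z: "z \<in> facets G x"
      show "?s x * ?s y * (?i (T ` x) (T ` z) * f (T ` z, T ` y)) = ?i x z * ?U f (z, y)"
        unfolding koopman_apply[OF T f zG[OF z] y]
        using arg_cong[OF incidence_image[OF G ord T x z], of "\<lambda>c. c * (?s y * f (T ` z, T ` y))"]
        by (simp only: mult_ac)
    qed simp
    have B: "?s x * ?s y * (\<Sum>z\<in>facets G (T ` y). ?i (T ` y) z * f (T ` x, z))
        = (\<Sum>z\<in>facets G y. ?i y z * ?U f (x, z))"
      unfolding reindex[OF y] sum_distrib_left
    proof (rule sum.cong)
      fix z assume z: "z \<in> facets G y"
      show "?s x * ?s y * (?i (T ` y) (T ` z) * f (T ` x, T ` z)) = ?i y z * ?U f (x, z)"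
        unfolding koopman_apply[OF T f x zG[OF z]]
        using arg_cong[OF incidence_image[OF G ord T y z], of "\<lambda>c. c * (?s x * f (T ` x, T ` z))"]
        by (simp only: mult_ac)
    qed simp
    have "?U (?d f) (x, y) = ?s x * ?s y * ?d f (T ` x, T ` y)"
      by (rule koopman_apply[OF T ext_d_in_forms x y])
    also have "\<dots> = ?d (?U f) (x, y)"
      unfolding ext_d_apply[OF koopman_in_forms x y] A[symmetric] B[symmetric]
        ext_d_apply[OF f automorphism_image[OF T x] automorphism_image[OF T y]] omega
      by (simp add: algebra_simps)
    finally show ?thesis by (simp add: p)
  qed
qed

lemma bij_betw_meeting_pairs:
  assumes G: "simplicial_complex G" and T: "automorphism G T"
  shows "bij_betw (\<lambda>(x, y). (T ` x, T ` y)) (meeting_pairs G) (meeting_pairs G)"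
proof -
  let ?t = "\<lambda>(x, y). (T ` x, T ` y)"
  have inj: "inj_on ?t (meeting_pairs G)"
    by (auto simp: inj_on_def inj_image_eq_iff[OF automorphism_inj[OF T]])
  have "?t ` meeting_pairs G \<subseteq> meeting_pairs G"
    using automorphism_image[OF T]
    by (auto simp: meeting_pairs_def image_Int[OF automorphism_inj[OF T], symmetric])
  then show ?thesis
    using endo_inj_surj[OF finite_meeting_pairs[OF G]] inj by (simp add: bij_betw_def)
qed

text \<open>The signs square to 1 and \<open>T\<close> permutes the meeting pairs.\<close>

lemma koopman_isometry:
  assumes G: "simplicial_complex G" and ord: "vertex_orders G ord" and T: "automorphism G T"
  shows "form_inner G (koopman G ord T f) (koopman G ord T h) = form_inner G f h"
proof -
  let ?t = "\<lambda>(x, y). (T ` x, T ` y)"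
  have "form_inner G (koopman G ord T f) (koopman G ord T h)
      = (\<Sum>p\<in>meeting_pairs G. f (?t p) * h (?t p))"
    unfolding form_inner_def
  proof (rule sum.cong)
    fix p assume p: "p \<in> meeting_pairs G"
    obtain x y where xy: "p = (x, y)" by (cases p)
    have x: "aut_sign ord T x * aut_sign ord T x = 1" and y: "aut_sign ord T y * aut_sign ord T y = 1"
      using p xy by (auto simp: meeting_pairs_def intro!: aut_sign_square[OF ord T])
    have "koopman G ord T f p * koopman G ord T h p
        = (aut_sign ord T x * aut_sign ord T x) * (aut_sign ord T y * aut_sign ord T y) *
          (f (T ` x, T ` y) * h (T ` x, T ` y))"
      using p xy by (simp add: koopman_def)
    then show "koopman G ord T f p * koopman G ord T h p = f (?t p) * h (?t p)"
      unfolding x y by (simp add: xy)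
  qed simp
  also have "\<dots> = form_inner G f h"
    unfolding form_inner_def
    by (rule sum.reindex_bij_betw[OF bij_betw_meeting_pairs[OF G T]])
  finally show ?thesis .
qed

definition pair_degree :: "'a set \<times> 'a set \<Rightarrow> nat" where
  "pair_degree = (\<lambda>(x, y). sdim x + sdim y)"

lemma degree_part_ext_d:
  shows "degree_part pair_degree (Suc k) (ext_d G ord f)
      = ext_d G ord (degree_part pair_degree k f)"
    and "degree_part pair_degree 0 (ext_d G ord f) = 0"
proof -
  have x: "degree_part pair_degree k f (z, y) = (if sdim x + sdim y = Suc k then f (z, y) else 0)"
    if "z \<in> facets G x" for x y z
    using sdim_facet[OF that] by (simp add: degree_part_def pair_degree_def)
  have y: "degree_part pair_degree k f (x, z) = (if sdim x + sdim y = Suc k then f (x, z) else 0)"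
    if "z \<in> facets G y" for x y z
    using sdim_facet[OF that] by (simp add: degree_part_def pair_degree_def)
  have "ext_dx G ord (degree_part pair_degree k f) (x, y)
      = (if sdim x + sdim y = Suc k then ext_dx G ord f (x, y) else 0)"
    and "ext_dy G ord (degree_part pair_degree k f) (x, y)
      = (if sdim x + sdim y = Suc k then ext_dy G ord f (x, y) else 0)" for x y
    by (simp_all add: ext_dx_def ext_dy_def x[of _ x] y[of _ y])
  then show "degree_part pair_degree (Suc k) (ext_d G ord f)
      = ext_d G ord (degree_part pair_degree k f)"
    by (auto simp: degree_part_def[of _ "Suc k"] ext_d_def pair_degree_def fun_eq_iff)
  \<comment> \<open>Vertices have no facets, so no term of the differential lands in total degree
    0.\<close>
  have "facets G x = {}" if "sdim x = 0" for x
    using that by (auto simp: facets_def)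
  then show "degree_part pair_degree 0 (ext_d G ord f) = 0"
    by (auto simp: degree_part_def pair_degree_def ext_d_def ext_dx_def ext_dy_def fun_eq_iff)
qed

lemma koopman_degree_part:
  assumes "automorphism G T"
  shows "koopman G ord T (degree_part pair_degree k f) = degree_part pair_degree k (koopman G ord T f)"
proof -
  have "sdim (T ` x) = sdim x" for x
    unfolding sdim_def
    using card_image[OF inj_on_subset[OF automorphism_inj[OF assms] subset_UNIV], of x] by simp
  then show ?thesis
    by (auto simp: koopman_def degree_part_def pair_degree_def fun_eq_iff)
qed

lemma pair_degree_le:
  assumes G: "simplicial_complex G" and p: "p \<in> meeting_pairs G"
  shows "pair_degree p \<le> 2 * max_dim G"
proof -
  have le: "sdim x \<le> max_dim G" if "x \<in> G" for x
    unfolding max_dim_def using simplicial_complexD(1)[OF G] that by (intro Max_ge) auto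
  obtain x y where "p = (x, y)" "x \<in> G" "y \<in> G"
    using p by (auto simp: meeting_pairs_def)
  then show ?thesis
    using le[of x] le[of y] by (simp add: pair_degree_def)
qed

theorem mainTheorem16:
  fixes G :: "'a set set" and ord :: "'a set \<Rightarrow> 'a list" and T :: "'a \<Rightarrow> 'a"
  assumes "simplicial_complex G"
    and "vertex_orders G ord"
    and "automorphism G T"
  shows "quadratic_lefschetz G ord T = (\<Sum>(x, y)\<in>fixed_pairs G T. pair_index ord T x y)"
proof -
  let ?M = "meeting_pairs G" and ?U = "koopman G ord T"
  note fin = finite_meeting_pairs[OF assms(1)]
  interpret lefschetz_complex ?M pair_degree "ext_d G ord" "form_adjoint G (ext_d G ord)" ?U
  proof (rule lefschetz_complex.intro, unfold forms_eq_supported[symmetric] form_inner_eq_inner_on[symmetric])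
    note lin = linear_op_ext_d[of G ord]
    show "finite ?M" by (rule fin)
    show "linear_op (ext_d G ord)" by (rule lin)
    show "linear_op (form_adjoint G (ext_d G ord))" by (rule linear_op_form_adjoint[OF assms(1) lin])
    show "linear_op ?U" by (rule linear_op_koopman)
    fix f assume f: "f \<in> forms G"
    show "ext_d G ord f \<in> forms G" by (rule ext_d_in_forms)
    show "form_adjoint G (ext_d G ord) f \<in> forms G"
      unfolding form_adjoint_eq(1)[OF assms(1) lin] by (simp add: forms_def)
    show "?U f \<in> forms G" by (rule koopman_in_forms)
    show "ext_d G ord (ext_d G ord f) = 0" by (rule ext_d_ext_d[OF assms(1,2) f])
    show "degree_part pair_degree (Suc k) (ext_d G ord f) = ext_d G ord (degree_part pair_degree k f)" for k
      by (rule degree_part_ext_d)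
    show "degree_part pair_degree 0 (ext_d G ord f) = 0" by (rule degree_part_ext_d)
    show "?U (ext_d G ord f) = ext_d G ord (?U f)" by (rule ext_d_koopman[OF assms f])
    show "?U (degree_part pair_degree k f) = degree_part pair_degree k (?U f)" for k
      by (rule koopman_degree_part[OF assms(3)])
    fix h
    show "form_inner G (ext_d G ord f) h = form_inner G f (form_adjoint G (ext_d G ord) h)"
      by (rule form_adjoint_eq(2)[OF assms(1) lin f])
    show "form_inner G (?U f) (?U h) = form_inner G f h"
      by (rule koopman_isometry[OF assms])
  qed
  have "ker_hodge G ord k = harmonic k" for k
  proof -
    have "D = dirac G ord"
      unfolding D_def[abs_def] dirac_def[abs_def] ..
    moreover have "degree_part pair_degree k f = f \<longleftrightarrow> (\<forall>x y. f (x, y) \<noteq> 0 \<longrightarrow> sdim x + sdim y = k)" for f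
      by (auto simp: degree_part_def pair_degree_def fun_eq_iff split: if_splits)
    ultimately show ?thesis
      by (auto simp: ker_hodge_def harmonic_def forms_deg_def hodge_def forms_eq_supported)
  qed
  then have "quadratic_lefschetz G ord T = (\<Sum>p\<in>?M. (-1) ^ pair_degree p * ?U (unit_at p) p)"
    using alternating_trace_harmonic[OF pair_degree_le[OF assms(1)]]
    by (simp add: quadratic_lefschetz_def)
  \<comment> \<open>\<open>unit_at (x, y)\<close> evaluated at the image pair is 1 exactly when
    \<open>T\<close> fixes both simplices, and the parity of the total degree splits as
    \<open>omega x * omega y\<close>.\<close>
  also have "\<dots> = (\<Sum>p\<in>?M. if p \<in> fixed_pairs G T then (case p of (x, y) \<Rightarrow> pair_index ord T x y) else 0)"
  proof (rule sum.cong)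
    fix p assume p: "p \<in> ?M"
    obtain x y where "p = (x, y)" by (cases p)
    then show "(-1) ^ pair_degree p * ?U (unit_at p) p
        = (if p \<in> fixed_pairs G T then (case p of (x, y) \<Rightarrow> pair_index ord T x y) else 0)"
      using p by (cases "T ` x = x"; cases "T ` y = y"; simp add: koopman_def unit_at_def
          fixed_pairs_def pair_index_def pair_degree_def omega_def power_add)
  qed simp
  also have "\<dots> = (\<Sum>(x, y)\<in>fixed_pairs G T. pair_index ord T x y)"
    using fin by (subst sum.If_cases) (auto intro!: sum.cong simp: fixed_pairs_def)
  finally show ?thesis .
qed

end
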